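(* Let $G$ be an amenable Cayley graph, let $p\in[0,1]$, and let $\omega$ be $p$-Bernoulli bond percolation on $G$. Then almost surely every cluster of $\omega$ is in $\mathcal{O}_{\mathbf{HD}}$.
   Context: A Cayley graph is the Cayley graph of a finitely generated group with respect to a finite generating set. $G$ is amenable if there are finite sets $V_1\subset V_2\subset\cdots\subset V(G)$ with $\bigcup_n V_n=V(G)$ and $|\partial_E V_n|/|V_n|\to0$, where $\partial_E V_n$ is the set of edges of $G$ with exactly one endpoint in $V_n$. $p$-Bernoulli bond percolation on $G$ is the random subgraph with vertex set $V(G)$ in which each edge of $G$ is kept independently with probability $p$; clusters are its connected components. For a connected locally finite graph $H$, a function $F:V(H)\to\mathbb{R}$ is harmonic if $F(x)=\sum_{y\sim x}F(y)/\deg_H x$ for all $x\in V(H)$, and Dirichlet if $\sum_x\sum_{y\sim x}|F(x)-F(y)|^2<\infty$. $\mathcal{O}_{\mathbf{HD}}$ is the class of graphs that admit no nonconstant harmonic Dirichlet functions (a single-vertex graph belongs to the class trivially). *)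

theory Defs
  imports "HOL-Probability.Probability" "HOL-Algebra.Generated_Groups"
begin

section \<open>Graphs\<close>

text \<open>
  Simple undirected graphs, possibly infinite. An edge is the two-element set of its endpoints.
\<close>

record 'a ugraph =
  vertices :: "'a set"
  edges :: "'a set set"

definition wf_ugraph :: "'a ugraph \<Rightarrow> bool" where
  "wf_ugraph H \<longleftrightarrow> (\<forall>e\<in>edges H. e \<subseteq> vertices H \<and> card e = 2)"

definition nbrs :: "'a ugraph \<Rightarrow> 'a \<Rightarrow> 'a set" where
  "nbrs H x = {y. {x, y} \<in> edges H}"

definition locally_finite :: "'a ugraph \<Rightarrow> bool" where
  "locally_finite H \<longleftrightarrow> (\<forall>x\<in>vertices H. finite (nbrs H x))"

definition deg :: "'a ugraph \<Rightarrow> 'a \<Rightarrow> nat" where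
  "deg H x = card (nbrs H x)"

definition reachable :: "'a ugraph \<Rightarrow> ('a \<times> 'a) set" where
  "reachable H = {(x, y). y \<in> nbrs H x}\<^sup>*"

definition connected_ugraph :: "'a ugraph \<Rightarrow> bool" where
  "connected_ugraph H \<longleftrightarrow> vertices H \<noteq> {} \<and> vertices H \<times> vertices H \<subseteq> reachable H"

definition component_of :: "'a ugraph \<Rightarrow> 'a \<Rightarrow> 'a ugraph" where
  "component_of H x =
     (let C = {y. (x, y) \<in> reachable H}
      in \<lparr>vertices = C, edges = {e \<in> edges H. e \<subseteq> C}\<rparr>)"

definition components :: "'a ugraph \<Rightarrow> 'a ugraph set" where
  "components H = component_of H ` vertices H"

definition edge_boundary :: "'a ugraph \<Rightarrow> 'a set \<Rightarrow> 'a set set" where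
  "edge_boundary H W = {e \<in> edges H. card (e \<inter> W) = 1}"

text \<open>
  The inclusions in the exhausting sequence need not be strict, so finite graphs are amenable.
  If the graph has a vertex, then all but finitely many of the sets are nonempty, and the value
  of the quotient for the empty set plays no role.
\<close>

definition amenable :: "'a ugraph \<Rightarrow> bool" where
  "amenable H \<longleftrightarrow>
     (\<exists>W :: nat \<Rightarrow> 'a set.
        (\<forall>n. finite (W n) \<and> W n \<subseteq> W (Suc n)) \<and> (\<Union>n. W n) = vertices H \<and>
        (\<lambda>n. real (card (edge_boundary H (W n))) / real (card (W n))) \<longlonglongrightarrow> 0)"


section \<open>Harmonic Dirichlet functions\<close>

text \<open>
  These notions are meant for connected locally finite graphs. Functions are defined on the
  whole type, but only their values on the vertices matter.
\<close>

definition harmonic :: "'a ugraph \<Rightarrow> ('a \<Rightarrow> real) \<Rightarrow> bool" where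
  "harmonic H F \<longleftrightarrow> (\<forall>x\<in>vertices H. F x = (\<Sum>y\<in>nbrs H x. F y / real (deg H x)))"

definition dirichlet :: "'a ugraph \<Rightarrow> ('a \<Rightarrow> real) \<Rightarrow> bool" where
  "dirichlet H F \<longleftrightarrow> (\<lambda>x. \<Sum>y\<in>nbrs H x. \<bar>F x - F y\<bar>\<^sup>2) summable_on vertices H"

definition O_HD :: "'a ugraph set" where
  "O_HD = {H. wf_ugraph H \<and> connected_ugraph H \<and> locally_finite H \<and>
              \<not> (\<exists>F. harmonic H F \<and> dirichlet H F \<and> \<not> F constant_on vertices H)}"


section \<open>Cayley graphs and Bernoulli bond percolation\<close>

text \<open>
  The generating set need not be symmetric. If it contains the identity, the resulting loops
  are discarded.
\<close>

definition cayley_graph :: "('a, 'b) monoid_scheme \<Rightarrow> 'a set \<Rightarrow> 'a ugraph" where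
  "cayley_graph G S =
     \<lparr>vertices = carrier G,
      edges = {{g, g \<otimes>\<^bsub>G\<^esub> s} | g s. g \<in> carrier G \<and> s \<in> S \<and> g \<otimes>\<^bsub>G\<^esub> s \<noteq> g}\<rparr>"

text \<open>
  A configuration maps each edge to \<^term>\<open>True\<close> if the edge is kept and to \<^term>\<open>False\<close> otherwise.
\<close>

definition bernoulli_percolation :: "'a ugraph \<Rightarrow> real \<Rightarrow> ('a set \<Rightarrow> bool) measure" where
  "bernoulli_percolation H p = (\<Pi>\<^sub>M e\<in>edges H. measure_pmf (bernoulli_pmf p))"

definition open_subgraph :: "'a ugraph \<Rightarrow> ('a set \<Rightarrow> bool) \<Rightarrow> 'a ugraph" where
  "open_subgraph H \<omega> = \<lparr>vertices = vertices H, edges = {e \<in> edges H. \<omega> e}\<rparr>"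

definition clusters :: "'a ugraph \<Rightarrow> ('a set \<Rightarrow> bool) \<Rightarrow> 'a ugraph set" where
  "clusters H \<omega> = components (open_subgraph H \<omega>)"

end

theory Submission imports Defs begin

text \<open>
  The proof compares dimensions, in the manner of von Neumann dimension. Fix a subgraph \<open>A\<close> of the
  Cayley graph and a finite vertex set \<open>V\<close>. A function that is harmonic at every vertex of \<open>V\<close> is
  determined by its values on the outer boundary of \<open>V\<close>, as far as its gradient on the arcs that
  start in \<open>V\<close> is concerned. So the gradients of such functions form a space of dimension at most
  the size of that boundary. The orthogonal projection onto this space has trace equal to the
  dimension, and its diagonal entry at an arc \<open>(x, y)\<close> is the largest possible value of
  \<open>(f x - f y)\<^sup>2\<close> among the functions \<open>f\<close> harmonic on \<open>V\<close> with energy at most \<open>1\<close> on these arcs. This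
  number is called the leverage of the arc, and \<open>sum_leverage_le\<close> states that the leverages of all
  arcs that start in \<open>V\<close> add up to at most the size of the boundary.

  Now let \<open>A\<close> be the percolation subgraph. Averaging over the vertices \<open>v\<close> of a Foelner set \<open>V\<close> shows that
  the expected leverage of some arc \<open>(v, v s)\<close> is at most \<open>|\<partial>V| / |V|\<close>, which is as small as desired.
  The law of percolation is invariant under translations, so \<open>(v, v s)\<close> may be moved to any given
  arc \<open>(x, x s)\<close>, with \<open>V\<close> replaced by a translate (\<open>small_expected_leverage\<close>). Hence almost
  surely the infimum over finite sets of the leverage of \<open>(x, x s)\<close> is zero. A harmonic Dirichlet
  function of a cluster, extended by zero and scaled to energy at most \<open>1\<close>, competes in the supremum for
  every finite set, so its gradient vanishes on every edge (\<open>harmonic_dirichlet_eq\<close>) and it is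
  constant.

  Working with finite sets throughout keeps every random quantity a function of finitely many edges,
  which makes measurability immediate.
\<close>

section \<open>Projections onto finite-dimensional spaces\<close>

text \<open>
  \<open>K\<close> is the matrix of the orthogonal projection onto the space of all \<open>T f\<close> with \<open>f \<in> F\<close>. Its trace is
  the dimension, which is at most \<open>card B\<close> because the values on \<open>B\<close> determine \<open>T f\<close>. The induction
  on \<open>B\<close> is the Gram-Schmidt process: allowing nonzero values at one more point \<open>b\<close> enlarges
  the space by at most one direction.
\<close>

lemma projection_kernel:
  fixes T :: "('a \<Rightarrow> real) \<Rightarrow> 'i \<Rightarrow> real" and F :: "('a \<Rightarrow> real) set"
  assumes "finite B" and I: "finite I"
    and F: "\<And>f g a b. f \<in> F \<Longrightarrow> g \<in> F \<Longrightarrow> (\<lambda>x. a * f x + b * g x) \<in> F"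
    and T: "\<And>f g a b i. T (\<lambda>x. a * f x + b * g x) i = a * T f i + b * T g i"
    and "\<And>f i. f \<in> F \<Longrightarrow> (\<And>b. b \<in> B \<Longrightarrow> f b = 0) \<Longrightarrow> i \<in> I \<Longrightarrow> T f i = 0"
  shows "\<exists>K. (\<forall>i j. K i j = K j i) \<and>
             (\<forall>f\<in>F. \<forall>i\<in>I. (\<Sum>j\<in>I. K i j * T f j) = T f i) \<and>
             (\<forall>i k. (\<Sum>j\<in>I. K i j * K j k) = K i k) \<and>
             (\<Sum>i\<in>I. K i i) \<le> real (card B)"
  using assms(1) F assms(5)
proof (induction B arbitrary: F rule: finite_induct)
  case empty
  then show ?case by (intro exI[of _ "\<lambda>_ _. 0"]) auto
next
  case (insert b B)
  define F' where "F' = {f \<in> F. f b = 0}"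
  have "\<exists>K. (\<forall>i j. K i j = K j i) \<and>
             (\<forall>f\<in>F'. \<forall>i\<in>I. (\<Sum>j\<in>I. K i j * T f j) = T f i) \<and>
             (\<forall>i k. (\<Sum>j\<in>I. K i j * K j k) = K i k) \<and>
             (\<Sum>i\<in>I. K i i) \<le> real (card B)"
  proof (rule insert.IH)
    show "(\<lambda>x. a * f x + c * g x) \<in> F'" if "f \<in> F'" "g \<in> F'" for f g a c
      using that insert.prems(1) by (auto simp: F'_def)
    show "T f i = 0" if "f \<in> F'" "\<And>b. b \<in> B \<Longrightarrow> f b = 0" "i \<in> I" for f i
      using that insert.prems(2)[of f i] by (auto simp: F'_def)
  qed
  then obtain K where sym: "\<And>i j. K i j = K j i"
    and rep: "\<And>f i. f \<in> F' \<Longrightarrow> i \<in> I \<Longrightarrow> (\<Sum>j\<in>I. K i j * T f j) = T f i"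
    and idem: "\<And>i k. (\<Sum>j\<in>I. K i j * K j k) = K i k"
    and tr: "(\<Sum>i\<in>I. K i i) \<le> real (card B)"
    by blast
  show ?case
  proof (cases "F' = F")
    case True
    then show ?thesis using sym rep idem tr insert.hyps by (intro exI[of _ K]) auto
  next
    case False
    then obtain g0 where g0: "g0 \<in> F" "g0 b \<noteq> 0" by (auto simp: F'_def)
    define g where "g = (\<lambda>x. (1 / g0 b) * g0 x + 0 * g0 x)"
    have g: "g \<in> F" "g b = 1"
      unfolding g_def using g0(2) by (blast intro: insert.prems(1)[OF g0(1) g0(1)], simp)
    \<comment> \<open>\<open>u\<close> is the new direction and \<open>v\<close> its component orthogonal to the space of \<open>F'\<close>.\<close>
    define u where "u = T g"
    define v where "v i = u i - (\<Sum>j\<in>I. K i j * u j)" for i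
    define s where "s = (\<Sum>i\<in>I. (v i)\<^sup>2)"
    have Kv: "(\<Sum>j\<in>I. K i j * v j) = 0" for i
    proof -
      have "(\<Sum>j\<in>I. K i j * (\<Sum>k\<in>I. K j k * u k)) = (\<Sum>j\<in>I. \<Sum>k\<in>I. K i j * K j k * u k)"
        by (simp add: sum_distrib_left mult.assoc)
      also have "\<dots> = (\<Sum>k\<in>I. (\<Sum>j\<in>I. K i j * K j k) * u k)"
        by (subst sum.swap) (simp add: sum_distrib_right)
      also have "\<dots> = (\<Sum>k\<in>I. K i k * u k)" by (simp add: idem)
      finally show ?thesis by (simp add: v_def right_diff_distrib sum_subtractf)
    qed
    have vK: "(\<Sum>i\<in>I. v i * (\<Sum>j\<in>I. K i j * w j)) = 0" for w
    proof -
      have "(\<Sum>i\<in>I. v i * (\<Sum>j\<in>I. K i j * w j)) = (\<Sum>i\<in>I. \<Sum>j\<in>I. K j i * v i * w j)"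
        by (simp add: sum_distrib_left mult_ac sym)
      also have "\<dots> = (\<Sum>j\<in>I. (\<Sum>i\<in>I. K j i * v i) * w j)"
        by (subst sum.swap) (simp add: sum_distrib_right)
      finally show ?thesis by (simp add: Kv)
    qed
    have split: "\<exists>f'\<in>F'. \<forall>i. T f i = T f' i + f b * u i" if "f \<in> F" for f
    proof
      show "(\<lambda>x. 1 * f x + (- f b) * g x) \<in> F'"
        using insert.prems(1)[OF that g(1), of 1 "- f b"] g(2) by (auto simp: F'_def)
      show "\<forall>i. T f i = T (\<lambda>x. 1 * f x + (- f b) * g x) i + f b * u i"
        unfolding T u_def by simp
    qed
    have v_orth: "(\<Sum>j\<in>I. v j * T f j) = 0" if "f \<in> F'" for f
      using vK[of "T f"] rep[OF that] by simp
    have vu: "(\<Sum>j\<in>I. v j * u j) = s"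
    proof -
      have "(\<Sum>j\<in>I. v j * u j) = (\<Sum>j\<in>I. (v j)\<^sup>2 + v j * (\<Sum>k\<in>I. K j k * u k))"
        by (intro sum.cong refl) (simp add: v_def power2_eq_square algebra_simps)
      then show ?thesis using vK[of u] by (simp add: sum.distrib s_def)
    qed
    \<comment> \<open>If \<open>s = 0\<close>, then \<open>u\<close> brings nothing new, and \<open>L = K\<close> because division by zero yields zero.\<close>
    define L where "L i j = K i j + v i * v j / s" for i j
    have Lsum: "(\<Sum>j\<in>I. L i j * w j) = (\<Sum>j\<in>I. K i j * w j) + v i / s * (\<Sum>j\<in>I. v j * w j)" for i w
      by (simp add: L_def sum.distrib sum_distrib_left algebra_simps)
    show ?thesis
    proof (intro exI[of _ L] conjI allI ballI)
      show "L i j = L j i" for i j by (simp add: L_def sym mult.commute)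
      show "(\<Sum>j\<in>I. L i j * T f j) = T f i" if f: "f \<in> F" and i: "i \<in> I" for f i
      proof -
        obtain f' where f': "f' \<in> F'" "\<And>i. T f i = T f' i + f b * u i"
          using split[OF f] by blast
        have "(\<Sum>j\<in>I. L i j * T f j) = (\<Sum>j\<in>I. L i j * T f' j) + f b * (\<Sum>j\<in>I. L i j * u j)"
          by (simp add: f'(2) algebra_simps sum.distrib sum_distrib_left)
        also have "(\<Sum>j\<in>I. L i j * T f' j) = T f' i"
          using rep[OF f'(1) i] v_orth[OF f'(1)] by (simp add: Lsum)
        also have "(\<Sum>j\<in>I. L i j * u j) = u i"
        proof (cases "s = 0")
          case True
          then have "v i = 0" using i I by (auto simp: s_def sum_nonneg_eq_0_iff)
          then show ?thesis using True by (simp add: Lsum v_def)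
        next
          case False
          then show ?thesis using vu by (simp add: Lsum) (simp add: v_def)
        qed
        finally show ?thesis using f'(2) by simp
      qed
      show "(\<Sum>j\<in>I. L i j * L j k) = L i k" for i k
      proof -
        have "(\<Sum>j\<in>I. K i j * L j k) = (\<Sum>j\<in>I. K i j * K j k) + (\<Sum>j\<in>I. K i j * v j) * (v k / s)"
          unfolding sum_distrib_right sum.distrib[symmetric]
          by (intro sum.cong refl) (simp add: L_def algebra_simps)
        then have "(\<Sum>j\<in>I. K i j * L j k) = K i k"
          using Kv[of i] idem[of i k] by simp
        moreover have "(\<Sum>j\<in>I. v j * L j k) = v k * s / s"
        proof -
          have "(\<Sum>j\<in>I. v j * L j k) = (\<Sum>j\<in>I. K k j * v j) + (\<Sum>j\<in>I. (v j)\<^sup>2 * (v k / s))"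
            unfolding sum.distrib[symmetric]
            by (intro sum.cong refl) (simp add: L_def sym[of k] power2_eq_square algebra_simps)
          also have "\<dots> = v k * s / s"
            unfolding Kv sum_distrib_right[symmetric] by (simp add: s_def)
          finally show ?thesis .
        qed
        ultimately show ?thesis by (simp add: Lsum) (simp add: L_def)
      qed
      have "(\<Sum>i\<in>I. L i i) = (\<Sum>i\<in>I. K i i) + s / s"
        unfolding L_def sum.distrib sum_divide_distrib[symmetric] s_def power2_eq_square ..
      also have "\<dots> \<le> real (card B) + 1" using tr by (intro add_mono) auto
      finally show "(\<Sum>i\<in>I. L i i) \<le> real (card (insert b B))" using insert.hyps by simp
    qed
  qed
qed


section \<open>Leverage of arcs at a finite vertex set\<close>

definition harmonic_on :: "'a ugraph \<Rightarrow> 'a set \<Rightarrow> ('a \<Rightarrow> real) \<Rightarrow> bool" where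
  "harmonic_on A V f \<longleftrightarrow> (\<forall>x\<in>V. (\<Sum>y\<in>nbrs A x. f x - f y) = 0)"

text \<open>
  Arcs are directed, so an edge inside \<open>V\<close> counts twice and an edge leaving \<open>V\<close> once. This is the
  convention of the sum in \<^const>\<open>dirichlet\<close>.
\<close>

definition energy :: "'a ugraph \<Rightarrow> 'a set \<Rightarrow> ('a \<Rightarrow> real) \<Rightarrow> real" where
  "energy A V f = (\<Sum>x\<in>V. \<Sum>y\<in>nbrs A x. (f x - f y)\<^sup>2)"

text \<open>
  For \<open>x \<in> V\<close> this is the diagonal entry at the arc \<open>(x, y)\<close> of the orthogonal projection onto the
  gradients of functions harmonic on \<open>V\<close>. As a supremum it needs no choice of a
  projection matrix, and it is visibly invariant under graph isomorphisms.
\<close>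

definition leverage :: "'a ugraph \<Rightarrow> 'a set \<Rightarrow> 'a \<Rightarrow> 'a \<Rightarrow> ennreal" where
  "leverage A V x y =
     (if y \<in> nbrs A x
      then SUP f\<in>{f. harmonic_on A V f \<and> energy A V f \<le> 1}. ennreal ((f x - f y)\<^sup>2) else 0)"

lemma nbrs_sym: "y \<in> nbrs A x \<longleftrightarrow> x \<in> nbrs A y"
  by (simp add: nbrs_def insert_commute)

text \<open>
  Uniqueness for the Dirichlet problem. On a component of \<open>V\<close> that does not meet the boundary \<open>f\<close> need not
  vanish, so only the gradient is claimed to be zero. Summation by parts covers all components at once:
  twice the sum over \<open>x\<close> of \<open>f x\<close> times the Laplacian of \<open>f\<close> at \<open>x\<close> is the total energy in \<open>V \<union> B\<close>.
\<close>

lemma harmonic_on_zero_boundary: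
  assumes fin: "finite V" "finite B"
    and nb: "\<And>x. x \<in> V \<Longrightarrow> nbrs A x \<subseteq> V \<union> B"
    and h: "harmonic_on A V f" and 0: "\<And>b. b \<in> B \<Longrightarrow> f b = 0"
    and xy: "x \<in> V" "y \<in> nbrs A x"
  shows "f x = f y"
proof -
  define W where "W = V \<union> B"
  define a where "a x y = (if y \<in> nbrs A x then 1 else 0 :: real)" for x y
  have a_sym: "a x y = a y x" for x y by (simp add: a_def nbrs_sym[of x])
  have finW: "finite W" using fin by (simp add: W_def)
  have "(\<Sum>y\<in>W. a x y * (f x * (f x - f y))) = 0" if "x \<in> W" for x
  proof (cases "x \<in> V")
    case True
    have "(\<Sum>y\<in>W. a x y * (f x * (f x - f y))) = (\<Sum>y\<in>nbrs A x. f x * (f x - f y))"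
      using nb[OF True] finW unfolding W_def[symmetric]
      by (intro sum.mono_neutral_cong_right) (auto simp: a_def)
    also have "\<dots> = 0" using h True by (simp add: harmonic_on_def flip: sum_distrib_left)
    finally show ?thesis .
  next
    case False
    then show ?thesis using that 0 by (simp add: W_def)
  qed
  then have Z: "(\<Sum>x\<in>W. \<Sum>y\<in>W. a x y * (f x * (f x - f y))) = 0" by simp
  then have Z': "(\<Sum>x\<in>W. \<Sum>y\<in>W. a x y * (f y * (f y - f x))) = 0"
    by (subst sum.swap) (simp add: a_sym)
  have "(\<Sum>x\<in>W. \<Sum>y\<in>W. a x y * (f x - f y)\<^sup>2) =
        (\<Sum>x\<in>W. \<Sum>y\<in>W. a x y * (f x * (f x - f y)) + a x y * (f y * (f y - f x)))"
    by (intro sum.cong refl) (simp add: power2_eq_square algebra_simps)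
  also have "\<dots> = 0" unfolding sum.distrib Z Z' by simp
  finally have "(\<Sum>x\<in>W. \<Sum>y\<in>W. a x y * (f x - f y)\<^sup>2) = 0" .
  then have "(\<Sum>y\<in>W. a x y * (f x - f y)\<^sup>2) = 0"
    using finW xy(1) by (subst (asm) sum_nonneg_eq_0_iff) (auto intro!: sum_nonneg simp: a_def W_def)
  moreover have "y \<in> W" using nb xy by (auto simp: W_def)
  ultimately have "a x y * (f x - f y)\<^sup>2 = 0"
    using finW by (subst (asm) sum_nonneg_eq_0_iff) (auto simp: a_def)
  then show ?thesis using xy(2) by (simp add: a_def)
qed

text \<open>
  The leverage of an arc is at most the diagonal entry of the projection matrix \<open>K\<close>: since \<open>K\<close>
  reproduces gradients and is symmetric and idempotent, the Cauchy-Schwarz inequality gives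
  \<open>(T f i)\<^sup>2 \<le> (\<Sum>j. (K i j)\<^sup>2) * energy = K i i * energy\<close>.
\<close>

lemma sum_leverage_le:
  assumes fin: "finite V" "finite B"
    and nb: "\<And>x. x \<in> V \<Longrightarrow> nbrs A x \<subseteq> V \<union> B"
  shows "(\<Sum>x\<in>V. \<Sum>y\<in>nbrs A x. leverage A V x y) \<le> of_nat (card B)"
proof -
  define F where "F = {f. harmonic_on A V f}"
  define I where "I = (SIGMA x:V. nbrs A x)"
  define T where "T f i = f (fst i) - f (snd i)" for f :: "'a \<Rightarrow> real" and i
  have fin_nbrs: "finite (nbrs A x)" if "x \<in> V" for x
    using nb[OF that] fin by (meson finite_UnI finite_subset)
  have finI: "finite I" unfolding I_def using fin_nbrs fin by (intro finite_SigmaI) auto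
  have energy: "energy A V f = (\<Sum>i\<in>I. (T f i)\<^sup>2)" for f
    unfolding energy_def I_def T_def using fin_nbrs fin by (subst sum.Sigma) (auto simp: case_prod_unfold)
  have "\<exists>K. (\<forall>i j. K i j = K j i) \<and>
             (\<forall>f\<in>F. \<forall>i\<in>I. (\<Sum>j\<in>I. K i j * T f j) = T f i) \<and>
             (\<forall>i k. (\<Sum>j\<in>I. K i j * K j k) = K i k) \<and>
             (\<Sum>i\<in>I. K i i) \<le> real (card B)"
  proof (rule projection_kernel[OF fin(2) finI])
    show "(\<lambda>x. a * f x + b * g x) \<in> F" if "f \<in> F" "g \<in> F" for f g a b
    proof -
      have "(\<Sum>y\<in>nbrs A x. a * f x + b * g x - (a * f y + b * g y)) =
            a * (\<Sum>y\<in>nbrs A x. f x - f y) + b * (\<Sum>y\<in>nbrs A x. g x - g y)" for x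
        unfolding sum_distrib_left sum.distrib[symmetric]
        by (intro sum.cong refl) (simp add: algebra_simps)
      then show ?thesis using that by (simp add: F_def harmonic_on_def)
    qed
    show "T (\<lambda>x. a * f x + b * g x) i = a * T f i + b * T g i" for f g a b i
      by (simp add: T_def algebra_simps)
    show "T f i = 0" if "f \<in> F" "\<And>b. b \<in> B \<Longrightarrow> f b = 0" "i \<in> I" for f i
      using harmonic_on_zero_boundary[where f = f and x = "fst i" and y = "snd i", OF fin nb] that
      by (auto simp: F_def I_def T_def)
  qed
  then obtain K where sym: "\<And>i j. K i j = K j i"
    and rep: "\<And>f i. f \<in> F \<Longrightarrow> i \<in> I \<Longrightarrow> (\<Sum>j\<in>I. K i j * T f j) = T f i"
    and idem: "\<And>i k. (\<Sum>j\<in>I. K i j * K j k) = K i k"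
    and tr: "(\<Sum>i\<in>I. K i i) \<le> real (card B)"
    by blast
  have diag: "K i i = (\<Sum>j\<in>I. (K i j)\<^sup>2)" for i
  proof -
    have "(K i j)\<^sup>2 = K i j * K j i" for j by (simp only: power2_eq_square sym[of j i])
    then show ?thesis by (simp only: idem)
  qed
  have diag_nonneg: "0 \<le> K i i" for i by (subst diag) (simp add: sum_nonneg)
  have lev: "leverage A V (fst i) (snd i) \<le> ennreal (K i i)" if i: "i \<in> I" for i
  proof -
    have "ennreal ((f (fst i) - f (snd i))\<^sup>2) \<le> ennreal (K i i)"
      if f: "harmonic_on A V f" "energy A V f \<le> 1" for f
    proof (rule ennreal_leI)
      have "(T f i)\<^sup>2 = (\<Sum>j\<in>I. K i j * T f j)\<^sup>2" using rep[of f i] f i by (simp add: F_def)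
      also have "\<dots> \<le> (\<Sum>j\<in>I. (K i j)\<^sup>2) * (\<Sum>j\<in>I. (T f j)\<^sup>2)" by (rule Cauchy_Schwarz_ineq_sum)
      also have "\<dots> = K i i * energy A V f" by (simp add: diag[symmetric] energy)
      also have "\<dots> \<le> K i i" using f(2) diag_nonneg by (rule mult_left_le)
      finally show "(f (fst i) - f (snd i))\<^sup>2 \<le> K i i" by (simp add: T_def)
    qed
    then show ?thesis using i by (auto simp: leverage_def I_def intro!: SUP_least)
  qed
  have "(\<Sum>x\<in>V. \<Sum>y\<in>nbrs A x. leverage A V x y) = (\<Sum>i\<in>I. leverage A V (fst i) (snd i))"
    unfolding I_def using fin_nbrs fin by (subst sum.Sigma) (auto simp: case_prod_unfold)
  also have "\<dots> \<le> (\<Sum>i\<in>I. ennreal (K i i))" by (intro sum_mono lev)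
  also have "\<dots> = ennreal (\<Sum>i\<in>I. K i i)" by (simp add: diag_nonneg)
  also have "\<dots> \<le> of_nat (card B)"
    using tr by (simp add: ennreal_of_nat_eq_real_of_nat ennreal_leI)
  finally show ?thesis .
qed

lemma leverage_pullback:
  assumes inj: "inj_on \<phi> X" and V: "V \<subseteq> X" and y: "y \<in> X" "x \<in> V"
    and nb: "\<And>x. x \<in> V \<Longrightarrow> nbrs A x \<subseteq> X" "\<And>x. x \<in> V \<Longrightarrow> nbrs B (\<phi> x) = \<phi> ` nbrs A x"
  shows "leverage B (\<phi> ` V) (\<phi> x) (\<phi> y) \<le> leverage A V x y"
proof -
  have sum_nbrs: "(\<Sum>z\<in>nbrs B (\<phi> v). g z) = (\<Sum>z\<in>nbrs A v. g (\<phi> z))" if "v \<in> V" for v and g :: "_ \<Rightarrow> real"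
    using nb(2)[OF that] inj_on_subset[OF inj nb(1)[OF that]] by (simp add: sum.reindex)
  have "energy B (\<phi> ` V) f = energy A V (f \<circ> \<phi>)" for f
    unfolding energy_def using inj_on_subset[OF inj V] by (simp add: sum.reindex sum_nbrs)
  moreover have "harmonic_on B (\<phi> ` V) f \<longleftrightarrow> harmonic_on A V (f \<circ> \<phi>)" for f
    by (simp add: harmonic_on_def sum_nbrs)
  moreover have "\<phi> y \<in> nbrs B (\<phi> x) \<longleftrightarrow> y \<in> nbrs A x"
    using inj y nb[of x] V by (auto dest: inj_onD)
  ultimately show ?thesis
    by (auto simp: leverage_def intro!: SUP_least intro: SUP_upper2[of "_ \<circ> \<phi>"])
qed

lemma leverage_cong:
  assumes "x \<in> V" "\<And>v. v \<in> V \<Longrightarrow> nbrs A v = nbrs B v"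
  shows "leverage A V x y = leverage B V x y"
  using assms by (simp add: leverage_def harmonic_on_def energy_def)

text \<open>
  If \<open>F x \<noteq> F y\<close>, then the extension of \<open>F\<close> by zero outside \<open>C\<close>, scaled to total energy at most
  \<open>1\<close>, bounds the leverage of \<open>(x, y)\<close> from below by the same positive number for every finite set.
\<close>

lemma harmonic_dirichlet_eq:
  assumes xy: "x \<in> C" "y \<in> nbrs A x"
    and nb: "\<And>v. v \<in> C \<Longrightarrow> nbrs A v \<subseteq> C"
    and harm: "\<And>v. v \<in> C \<Longrightarrow> F v = (\<Sum>z\<in>nbrs A v. F z / real (deg A v))"
    and diri: "(\<lambda>v. \<Sum>z\<in>nbrs A v. \<bar>F v - F z\<bar>\<^sup>2) summable_on C"
    and lev: "\<And>\<delta>. \<delta> > 0 \<Longrightarrow> \<exists>W. finite W \<and> leverage A W x y < ennreal \<delta>"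
  shows "F x = F y"
proof (rule ccontr)
  assume ne: "F x \<noteq> F y"
  define E where "E = infsum (\<lambda>v. \<Sum>z\<in>nbrs A v. \<bar>F v - F z\<bar>\<^sup>2) C"
  have E0: "0 \<le> E" unfolding E_def by (intro infsum_nonneg sum_nonneg) auto
  \<comment> \<open>The summand \<open>1\<close> avoids a division by zero without a separate treatment of \<open>E = 0\<close>.\<close>
  define c where "c = 1 / sqrt (1 + E)"
  have c: "c > 0" "c\<^sup>2 * E \<le> 1" using E0 by (auto simp: c_def power_divide)
  define f where "f v = (if v \<in> C then c * F v else 0)" for v
  have nbC: "z \<in> C \<longleftrightarrow> v \<in> C" if "z \<in> nbrs A v" for v z
    using nb that nbrs_sym[of z A v] by blast
  have harm_f: "(\<Sum>z\<in>nbrs A v. f v - f z) = 0" for v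
  proof (cases "v \<in> C")
    case True
    show ?thesis
    proof (cases "deg A v = 0")
      \<comment> \<open>The degree is zero if there are no neighbours or infinitely many; the sum is then zero too.\<close>
      case True
      then show ?thesis by (cases "finite (nbrs A v)") (auto simp: deg_def)
    next
      case False
      have "(\<Sum>z\<in>nbrs A v. f v - f z) = (\<Sum>z\<in>nbrs A v. c * F v - c * F z)"
        using True nbC by (intro sum.cong refl) (auto simp: f_def)
      also have "\<dots> = c * (real (deg A v) * F v - (\<Sum>z\<in>nbrs A v. F z))"
        by (simp add: sum_subtractf deg_def right_diff_distrib flip: sum_distrib_left)
      also have "\<dots> = 0"
        using harm[OF True] False by (simp add: field_simps flip: sum_divide_distrib)
      finally show ?thesis .
    qed
  next
    case False
    then show ?thesis using nbC by (intro sum.neutral) (auto simp: f_def)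
  qed
  have en: "energy A W f \<le> 1" if "finite W" for W
  proof -
    have "energy A W f = (\<Sum>v\<in>W \<inter> C. c\<^sup>2 * (\<Sum>z\<in>nbrs A v. \<bar>F v - F z\<bar>\<^sup>2))"
      unfolding energy_def
    proof (rule sum.mono_neutral_cong_right[OF that])
      show "\<forall>v\<in>W - W \<inter> C. (\<Sum>z\<in>nbrs A v. (f v - f z)\<^sup>2) = 0"
        using nbC by (auto intro!: sum.neutral simp: f_def)
      show "(\<Sum>z\<in>nbrs A v. (f v - f z)\<^sup>2) = c\<^sup>2 * (\<Sum>z\<in>nbrs A v. \<bar>F v - F z\<bar>\<^sup>2)" if "v \<in> W \<inter> C" for v
        unfolding sum_distrib_left using that nbC
        by (intro sum.cong refl) (auto simp: f_def power_mult_distrib simp flip: right_diff_distrib)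
    qed auto
    also have "\<dots> \<le> c\<^sup>2 * E" unfolding sum_distrib_left[symmetric] E_def
      using that by (intro mult_left_mono finite_sum_le_infsum diri sum_nonneg) auto
    finally show ?thesis using c by simp
  qed
  have "(f x - f y)\<^sup>2 > 0" using ne xy nb c by (auto simp: f_def)
  then obtain W where W: "finite W" "leverage A W x y < ennreal ((f x - f y)\<^sup>2)" using lev by blast
  moreover have "ennreal ((f x - f y)\<^sup>2) \<le> leverage A W x y"
    using xy harm_f en[OF W(1)] by (auto simp: leverage_def harmonic_on_def intro!: SUP_upper)
  ultimately show False by simp
qed

section \<open>Clusters without nonconstant harmonic Dirichlet functions\<close>

lemma reachable_nbr:
  "(x, y) \<in> reachable A \<Longrightarrow> z \<in> nbrs A y \<Longrightarrow> (x, z) \<in> reachable A"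
  unfolding reachable_def by (rule rtrancl_into_rtrancl) auto

lemma reachable_sym: "(x, y) \<in> reachable A \<Longrightarrow> (y, x) \<in> reachable A"
proof -
  have "sym {(x, y). y \<in> nbrs A x}" by (auto simp: sym_def nbrs_sym)
  then show "(x, y) \<in> reachable A \<Longrightarrow> (y, x) \<in> reachable A"
    unfolding reachable_def by (blast dest: sym_rtrancl symD)
qed

lemma vertices_component: "vertices (component_of A x) = {y. (x, y) \<in> reachable A}"
  by (simp add: component_of_def Let_def)

lemma nbrs_component:
  assumes "(x, y) \<in> reachable A"
  shows "nbrs (component_of A x) y = nbrs A y"
  using assms reachable_nbr[OF assms] by (auto simp: component_of_def Let_def nbrs_def)

lemma reachable_component:
  assumes "(x, y) \<in> reachable A"
  shows "(x, y) \<in> reachable (component_of A x)"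
  using assms unfolding reachable_def[of A]
proof (induction rule: rtrancl_induct)
  case base
  then show ?case by (simp add: reachable_def)
next
  case (step y z)
  then have "z \<in> nbrs (component_of A x) y"
    using nbrs_component[of x y A] by (simp add: reachable_def)
  with step.IH show ?case by (rule reachable_nbr)
qed

text \<open>
  Each edge needs small leverages in one of its two directions only, since the conclusion \<open>F x = F y\<close>
  is symmetric. In a Cayley graph this is the direction along the generator.
\<close>

lemma component_in_O_HD:
  assumes wf: "wf_ugraph A" and lf: "locally_finite A"
    and lev: "\<And>e. e \<in> edges A \<Longrightarrow>
      \<exists>x y. e = {x, y} \<and> (\<forall>\<delta>>0. \<exists>W. finite W \<and> leverage A W x y < ennreal \<delta>)"
  shows "component_of A r \<in> O_HD"
proof -
  define H where "H = component_of A r"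
  define C where "C = {y. (r, y) \<in> reachable A}"
  have C: "vertices H = C" by (simp add: H_def C_def vertices_component)
  have nb: "nbrs H v = nbrs A v" if "v \<in> C" for v
    using that by (simp add: H_def C_def nbrs_component)
  have nbC: "nbrs A v \<subseteq> C" if "v \<in> C" for v
    using that reachable_nbr[of r v A] by (auto simp: C_def)
  have "wf_ugraph H"
    using wf by (auto simp: wf_ugraph_def H_def component_of_def Let_def)
  moreover have "locally_finite H"
    unfolding locally_finite_def C
  proof
    fix v assume v: "v \<in> C"
    show "finite (nbrs H v)"
    proof (cases "v \<in> vertices A")
      case True
      then show ?thesis using lf nb[OF v] by (simp add: locally_finite_def)
    next
      case False
      then have "nbrs A v = {}" using wf by (auto simp: wf_ugraph_def nbrs_def)
      then show ?thesis using nb[OF v] by simp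
    qed
  qed
  moreover have "connected_ugraph H"
  proof -
    have "(u, v) \<in> reachable H" if "u \<in> C" "v \<in> C" for u v
    proof -
      have "(r, u) \<in> reachable H" "(r, v) \<in> reachable H"
        using that by (auto simp: C_def H_def intro: reachable_component)
      then show ?thesis
        using reachable_sym[of r u H] unfolding reachable_def by (blast intro: rtrancl_trans)
    qed
    moreover have "r \<in> C" by (simp add: C_def reachable_def)
    ultimately show ?thesis by (auto simp: connected_ugraph_def C)
  qed
  moreover have "F constant_on vertices H" if F: "harmonic H F" "dirichlet H F" for F
  proof -
    have harm: "F v = (\<Sum>z\<in>nbrs A v. F z / real (deg A v))" if "v \<in> C" for v
      using F(1) that nb[OF that] by (simp add: harmonic_def C deg_def)
    have diri: "(\<lambda>v. \<Sum>z\<in>nbrs A v. \<bar>F v - F z\<bar>\<^sup>2) summable_on C"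
      using F(2) nb unfolding dirichlet_def C by (subst summable_on_cong[symmetric]) auto
    have edge_eq: "F u = F v" if uv: "u \<in> C" "v \<in> nbrs A u" for u v
    proof -
      obtain x y where xy: "{u, v} = {x, y}"
        and small: "\<And>\<delta>. \<delta> > 0 \<Longrightarrow> \<exists>W. finite W \<and> leverage A W x y < ennreal \<delta>"
        using lev[of "{u, v}"] uv(2) by (auto simp: nbrs_def)
      have "x \<in> C" "y \<in> nbrs A x"
        using xy uv nbC[OF uv(1)] by (auto simp: doubleton_eq_iff nbrs_sym)
      then have "F x = F y" using nbC harm diri small by (rule harmonic_dirichlet_eq)
      then show ?thesis using xy by (auto simp: doubleton_eq_iff)
    qed
    have "F v = F r" if "(r, v) \<in> reachable A" for v
      using that unfolding reachable_def
    proof (induction rule: rtrancl_induct)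
      case (step y z)
      then show ?case using edge_eq[of y z]
        by (simp add: C_def reachable_def)
    qed simp
    then show ?thesis unfolding constant_on_def C by (auto simp: C_def)
  qed
  ultimately show ?thesis by (auto simp: O_HD_def H_def)
qed

section \<open>Locality and measurability\<close>

lemma vertices_open_subgraph: "vertices (open_subgraph H \<omega>) = vertices H"
  by (simp add: open_subgraph_def)

lemma nbrs_open_subgraph: "nbrs (open_subgraph H \<omega>) x = {y \<in> nbrs H x. \<omega> {x, y}}"
  by (auto simp: open_subgraph_def nbrs_def)

lemma finite_edges_at:
  assumes wf: "wf_ugraph H" and lf: "locally_finite H" and W: "finite W" "W \<subseteq> vertices H"
  shows "finite {e \<in> edges H. e \<inter> W \<noteq> {}}"
proof (rule finite_subset)
  show "{e \<in> edges H. e \<inter> W \<noteq> {}} \<subseteq> (\<Union>w\<in>W. (\<lambda>y. {w, y}) ` nbrs H w)"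
  proof
    fix e assume "e \<in> {e \<in> edges H. e \<inter> W \<noteq> {}}"
    then obtain w where e: "e \<in> edges H" "w \<in> e" "w \<in> W" by auto
    then have "card e = 2" using wf by (simp add: wf_ugraph_def)
    then obtain a b where "e = {a, b}" unfolding card_2_iff by blast
    then have "\<exists>y. e = {w, y}" using e(2) by blast
    then show "e \<in> (\<Union>w\<in>W. (\<lambda>y. {w, y}) ` nbrs H w)" using e by (auto simp: nbrs_def)
  qed
  show "finite (\<Union>w\<in>W. (\<lambda>y. {w, y}) ` nbrs H w)"
    using W lf by (auto simp: locally_finite_def)
qed

text \<open>
  The leverage depends only on the states of the finitely many edges that meet \<open>W\<close>, and every
  function of finitely many states is measurable.
\<close>

lemma measurable_leverage:
  assumes wf: "wf_ugraph H" and lf: "locally_finite H" and W: "finite W" "W \<subseteq> vertices H" and x: "x \<in> W"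
  shows "(\<lambda>\<omega>. leverage (open_subgraph H \<omega>) W x y) \<in> borel_measurable (bernoulli_percolation H p)"
proof -
  define J where "J = {e \<in> edges H. e \<inter> W \<noteq> {}}"
  let ?N = "PiM J (\<lambda>_. count_space (UNIV :: bool set))"
  have J: "finite J" unfolding J_def by (rule finite_edges_at[OF wf lf W])
  have local: "leverage (open_subgraph H (restrict \<omega> J)) W x y = leverage (open_subgraph H \<omega>) W x y" for \<omega>
    using x by (rule leverage_cong) (auto simp: open_subgraph_def nbrs_def J_def)
  have restr: "(\<lambda>\<omega>. restrict \<omega> J) \<in> bernoulli_percolation H p \<rightarrow>\<^sub>M ?N"
    unfolding bernoulli_percolation_def by (rule measurable_restrict_subset') (auto simp: J_def)
  have "(\<lambda>\<omega>. leverage (open_subgraph H \<omega>) W x y) \<in> borel_measurable ?N"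
    unfolding count_space_PiM_finite[OF J, of "\<lambda>_. UNIV :: bool set", OF countableI_type] by simp
  from measurable_compose[OF restr this] show ?thesis
    unfolding local .
qed

text \<open>Each outer boundary vertex is the unique endpoint outside \<open>W\<close> of some boundary edge.\<close>

lemma card_outer_boundary_le:
  assumes wf: "wf_ugraph H" and lf: "locally_finite H" and W: "finite W" "W \<subseteq> vertices H"
  shows "card ((\<Union>w\<in>W. nbrs H w) - W) \<le> card (edge_boundary H W)"
proof -
  have fin: "finite (edge_boundary H W)"
  proof (rule finite_subset)
    show "edge_boundary H W \<subseteq> {e \<in> edges H. e \<inter> W \<noteq> {}}"
      unfolding edge_boundary_def by auto
  qed (rule finite_edges_at[OF wf lf W])
  have "(\<Union>w\<in>W. nbrs H w) - W \<subseteq> (\<lambda>e. THE b. b \<in> e - W) ` edge_boundary H W"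
  proof
    fix b assume "b \<in> (\<Union>w\<in>W. nbrs H w) - W"
    then obtain w where w: "w \<in> W" "{w, b} \<in> edges H" "b \<notin> W" by (auto simp: nbrs_def)
    then have "{w, b} \<inter> W = {w}" by auto
    with w have "{w, b} \<in> edge_boundary H W" by (simp add: edge_boundary_def)
    moreover have "(THE b'. b' \<in> {w, b} - W) = b" using w by (intro the_equality) auto
    ultimately show "b \<in> (\<lambda>e. THE b. b \<in> e - W) ` edge_boundary H W" by (intro image_eqI[of _ _ "{w, b}"]) simp_all
  qed
  with fin show ?thesis by (rule surj_card_le)
qed

section \<open>Percolation on amenable Cayley graphs\<close>

context group
begin

lemma wf_cayley_graph: "S \<subseteq> carrier G \<Longrightarrow> wf_ugraph (cayley_graph G S)"
  by (auto simp: wf_ugraph_def cayley_graph_def)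

lemma locally_finite_cayley_graph:
  assumes "finite S" "S \<subseteq> carrier G"
  shows "locally_finite (cayley_graph G S)"
  unfolding locally_finite_def
proof
  fix x assume "x \<in> vertices (cayley_graph G S)"
  have "nbrs (cayley_graph G S) x \<subseteq> (\<lambda>s. x \<otimes> s) ` S \<union> (\<lambda>s. x \<otimes> inv s) ` S"
  proof
    fix y assume "y \<in> nbrs (cayley_graph G S) x"
    then obtain g s where gs: "{x, y} = {g, g \<otimes> s}" "g \<in> carrier G" "s \<in> S"
      by (auto simp: nbrs_def cayley_graph_def)
    then have "x \<otimes> s = y \<or> x \<otimes> inv s = y"
      using assms(2) by (auto simp: doubleton_eq_iff m_assoc)
    then show "y \<in> (\<lambda>s. x \<otimes> s) ` S \<union> (\<lambda>s. x \<otimes> inv s) ` S"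
      using gs(3) by blast
  qed
  then show "finite (nbrs (cayley_graph G S) x)" using assms(1) by (meson finite_UnI finite_imageI finite_subset)
qed

lemma translate_edge:
  assumes "S \<subseteq> carrier G" "g \<in> carrier G" "e \<in> edges (cayley_graph G S)"
  shows "(\<otimes>) g ` e \<in> edges (cayley_graph G S)"
proof -
  obtain h s where e: "e = {h, h \<otimes> s}" "h \<in> carrier G" "s \<in> S" "h \<otimes> s \<noteq> h"
    using assms(3) by (auto simp: cayley_graph_def)
  have "s \<in> carrier G" using e assms by auto
  then have "(\<otimes>) g ` e = {g \<otimes> h, g \<otimes> h \<otimes> s}" "g \<otimes> h \<otimes> s \<noteq> g \<otimes> h"
    using e assms by (auto simp: m_assoc)
  then show ?thesis using e assms by (auto simp: cayley_graph_def)
qed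

definition translate :: "'a set \<Rightarrow> 'a \<Rightarrow> ('a set \<Rightarrow> bool) \<Rightarrow> ('a set \<Rightarrow> bool)" where
  "translate S g \<omega> = (\<lambda>e\<in>edges (cayley_graph G S). \<omega> ((\<otimes>) g ` e))"

text \<open>Left translation permutes the edges, whose states are independent and identically distributed.\<close>

lemma distr_translate:
  assumes "S \<subseteq> carrier G" "g \<in> carrier G"
  shows "distr (bernoulli_percolation (cayley_graph G S) p) (bernoulli_percolation (cayley_graph G S) p)
           (translate S g) = bernoulli_percolation (cayley_graph G S) p"
proof -
  have "inj_on ((`) ((\<otimes>) g)) (edges (cayley_graph G S))"
  proof (rule inj_on_subset)
    show "inj_on ((`) ((\<otimes>) g)) (Pow (carrier G))"
      using assms(2) by (intro inj_on_image_Pow) (auto intro: inj_onI)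
    show "edges (cayley_graph G S) \<subseteq> Pow (carrier G)"
      using wf_cayley_graph[OF assms(1)] by (auto simp: wf_ugraph_def cayley_graph_def)
  qed
  moreover have "(`) ((\<otimes>) g) \<in> edges (cayley_graph G S) \<rightarrow> edges (cayley_graph G S)"
    using translate_edge[OF assms] by auto
  ultimately show ?thesis
    unfolding bernoulli_percolation_def translate_def
    by (intro distr_PiM_reindex) (auto simp: prob_space_measure_pmf)
qed

text \<open>
  The translated configuration has at an edge the state that \<open>\<omega>\<close> has at the edge moved by \<open>g\<close>, so
  its open subgraph is the image of the original one under the inverse of \<open>g\<close>.
\<close>

lemma nbrs_translate:
  assumes S: "S \<subseteq> carrier G" and g: "g \<in> carrier G" and v: "v \<in> carrier G"
  shows "nbrs (open_subgraph (cayley_graph G S) (translate S g \<omega>)) (inv g \<otimes> v) =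
         (\<otimes>) (inv g) ` nbrs (open_subgraph (cayley_graph G S) \<omega>) v" (is "?L = ?R")
proof
  let ?H = "cayley_graph G S"
  have carr: "y \<in> carrier G" if "{x, y} \<in> edges ?H" for x y
    using wf_cayley_graph[OF S] that by (auto simp: wf_ugraph_def cayley_graph_def)
  show "?L \<subseteq> ?R"
  proof
    fix y assume "y \<in> ?L"
    then have y: "{inv g \<otimes> v, y} \<in> edges ?H" "\<omega> {v, g \<otimes> y}"
      using g v by (auto simp: open_subgraph_def nbrs_def translate_def r_inv_ex m_assoc[symmetric])
    then have "{v, g \<otimes> y} \<in> edges ?H"
      using translate_edge[OF S g y(1)] g v by (simp add: m_assoc[symmetric])
    moreover have "y = inv g \<otimes> (g \<otimes> y)" using carr[OF y(1)] g by (simp add: m_assoc[symmetric])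
    ultimately show "y \<in> ?R" using y by (auto simp: open_subgraph_def nbrs_def)
  qed
  show "?R \<subseteq> ?L"
  proof
    fix z assume "z \<in> ?R"
    then obtain y where y: "{v, y} \<in> edges ?H" "\<omega> {v, y}" "z = inv g \<otimes> y"
      by (auto simp: open_subgraph_def nbrs_def)
    have "{inv g \<otimes> v, z} \<in> edges ?H"
      using translate_edge[OF S _ y(1), of "inv g"] g y(3) by simp
    moreover have "\<omega> {g \<otimes> (inv g \<otimes> v), g \<otimes> z}"
      using y carr[OF y(1)] g v by (simp add: m_assoc[symmetric])
    ultimately show "z \<in> ?L" by (simp add: open_subgraph_def nbrs_def translate_def)
  qed
qed

lemma expected_leverage_translate:
  fixes p :: real
  assumes S: "finite S" "S \<subseteq> carrier G" and g: "g \<in> carrier G"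
    and V: "finite V" "V \<subseteq> carrier G" and v: "v \<in> V" and w: "w \<in> carrier G"
  defines "M \<equiv> bernoulli_percolation (cayley_graph G S) p"
  shows "(\<integral>\<^sup>+\<omega>. leverage (open_subgraph (cayley_graph G S) \<omega>) ((\<otimes>) (inv g) ` V) (inv g \<otimes> v) (inv g \<otimes> w) \<partial>M)
       \<le> (\<integral>\<^sup>+\<omega>. leverage (open_subgraph (cayley_graph G S) \<omega>) V v w \<partial>M)"
proof -
  let ?H = "cayley_graph G S"
  let ?W = "(\<otimes>) (inv g) ` V"
  let ?f = "\<lambda>\<omega>. leverage (open_subgraph ?H \<omega>) ?W (inv g \<otimes> v) (inv g \<otimes> w)"
  have meas: "?f \<in> borel_measurable M"
    unfolding M_def
    by (intro measurable_leverage wf_cayley_graph locally_finite_cayley_graph S finite_imageI V imageI v)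
      (use V g in \<open>auto simp: cayley_graph_def\<close>)
  have trans: "translate S g \<in> M \<rightarrow>\<^sub>M M"
    unfolding M_def bernoulli_percolation_def translate_def
    using translate_edge[OF S(2) g] by (intro measurable_restrict measurable_component_singleton) auto
  have "integral\<^sup>N M ?f = integral\<^sup>N (distr M M (translate S g)) ?f"
    unfolding M_def distr_translate[OF S(2) g] ..
  also have "\<dots> = (\<integral>\<^sup>+\<omega>. ?f (translate S g \<omega>) \<partial>M)"
    by (rule nn_integral_distr[OF trans]) (simp add: meas)
  also have "\<dots> \<le> (\<integral>\<^sup>+\<omega>. leverage (open_subgraph ?H \<omega>) V v w \<partial>M)"
  proof (rule nn_integral_mono, rule leverage_pullback[where X = "carrier G"])
    show "inj_on ((\<otimes>) (inv g)) (carrier G)" using g by (auto intro: inj_onI)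
    show "nbrs (open_subgraph ?H \<omega>) x \<subseteq> carrier G" for \<omega> x
      using wf_cayley_graph[OF S(2)]
      by (auto simp: open_subgraph_def nbrs_def wf_ugraph_def cayley_graph_def)
    show "nbrs (open_subgraph ?H (translate S g \<omega>)) (inv g \<otimes> x) =
        (\<otimes>) (inv g) ` nbrs (open_subgraph ?H \<omega>) x" if "x \<in> V" for \<omega> x
      using that V by (intro nbrs_translate S g) auto
  qed (use V v w in auto)
  finally show ?thesis .
qed

text \<open>
  The leverages of the arcs \<open>(v, v s)\<close>, with \<open>v\<close> in a Foelner set \<open>U\<close>, have total expectation at
  most the size of the boundary of \<open>U\<close>. So one of these arcs has small expected leverage, and a translation
  moves it to \<open>(x, x s)\<close>.
\<close>

lemma small_expected_leverage:
  fixes p :: real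
  assumes S: "finite S" "S \<subseteq> carrier G" and am: "amenable (cayley_graph G S)"
    and x: "x \<in> carrier G" and s: "s \<in> S" and \<epsilon>: "\<epsilon> > 0"
  defines "M \<equiv> bernoulli_percolation (cayley_graph G S) p"
  shows "\<exists>W. finite W \<and> W \<subseteq> carrier G \<and> x \<in> W \<and>
    (\<integral>\<^sup>+\<omega>. leverage (open_subgraph (cayley_graph G S) \<omega>) W x (x \<otimes> s) \<partial>M) \<le> ennreal \<epsilon>"
proof -
  let ?H = "cayley_graph G S"
  have H: "wf_ugraph ?H" "locally_finite ?H" "vertices ?H = carrier G"
    using S wf_cayley_graph locally_finite_cayley_graph by (auto simp: cayley_graph_def)
  interpret M: prob_space M
    unfolding M_def bernoulli_percolation_def by (intro prob_space_PiM prob_space_measure_pmf)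
  obtain V :: "nat \<Rightarrow> 'a set" where V: "\<And>n. finite (V n)" "\<And>n. V n \<subseteq> V (Suc n)" "(\<Union>n. V n) = carrier G"
    and lim: "(\<lambda>n. real (card (edge_boundary ?H (V n))) / real (card (V n))) \<longlonglongrightarrow> 0"
    using am unfolding amenable_def H by blast
  obtain n0 where n0: "\<one> \<in> V n0" using V(3) one_closed by blast
  have "\<forall>\<^sub>F n in sequentially. real (card (edge_boundary ?H (V n))) / real (card (V n)) < \<epsilon>"
    using lim \<epsilon> by (rule order_tendstoD)
  then obtain n where n: "n \<ge> n0" "real (card (edge_boundary ?H (V n))) / real (card (V n)) < \<epsilon>"
    unfolding eventually_sequentially by (meson nle_le)
  \<comment> \<open>The choice \<open>n \<ge> n0\<close> excludes an empty set, for which the quotient is zero by convention.\<close>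
  define U where "U = V n"
  have "V n0 \<subseteq> V n" using lift_Suc_mono_le[of V, OF V(2) n(1)] .
  then have U: "finite U" "U \<subseteq> carrier G" "card U > 0"
    using V n0 by (auto simp: U_def card_gt_0_iff)
  define B where "B = (\<Union>w\<in>U. nbrs ?H w) - U"
  have B: "finite B" using U H by (auto simp: B_def locally_finite_def)
  have "real (card B) \<le> real (card (edge_boundary ?H U))"
    unfolding B_def using card_outer_boundary_le[OF H(1,2), of U] U H(3) by simp
  also have "\<dots> < \<epsilon> * real (card U)" using n(2) U(3) by (simp add: U_def field_simps)
  finally have cardB: "real (card B) < \<epsilon> * real (card U)" .
  let ?l = "\<lambda>\<omega> v. leverage (open_subgraph ?H \<omega>) U v (v \<otimes> s)"
  have "\<exists>v\<in>U. (\<integral>\<^sup>+\<omega>. ?l \<omega> v \<partial>M) \<le> ennreal \<epsilon>"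
  proof (rule ccontr)
    assume "\<not> ?thesis"
    then have "(\<Sum>v\<in>U. ennreal \<epsilon>) \<le> (\<Sum>v\<in>U. \<integral>\<^sup>+\<omega>. ?l \<omega> v \<partial>M)" by (intro sum_mono) force
    also have "\<dots> = (\<integral>\<^sup>+\<omega>. (\<Sum>v\<in>U. ?l \<omega> v) \<partial>M)"
      unfolding M_def using U H by (intro nn_integral_sum[symmetric] measurable_leverage) auto
    also have "\<dots> \<le> (\<integral>\<^sup>+\<omega>. of_nat (card B) \<partial>M)"
    proof (rule nn_integral_mono)
      fix \<omega>
      let ?A = "open_subgraph ?H \<omega>"
      have nb: "nbrs ?A v \<subseteq> U \<union> B" if "v \<in> U" for v
        using that by (auto simp: B_def nbrs_open_subgraph)
      have "?l \<omega> v \<le> (\<Sum>y\<in>nbrs ?A v. leverage ?A U v y)" if "v \<in> U" for v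
      proof (cases "v \<otimes> s \<in> nbrs ?A v")
        case True
        moreover have "finite (nbrs ?A v)" using nb[OF that] U B by (meson finite_UnI finite_subset)
        ultimately show ?thesis by (intro member_le_sum) auto
      qed (simp add: leverage_def)
      then have "(\<Sum>v\<in>U. ?l \<omega> v) \<le> (\<Sum>v\<in>U. \<Sum>y\<in>nbrs ?A v. leverage ?A U v y)" by (rule sum_mono)
      also have "\<dots> \<le> of_nat (card B)"
        by (rule sum_leverage_le[OF U(1) B nb])
      finally show "(\<Sum>v\<in>U. ?l \<omega> v) \<le> of_nat (card B)" .
    qed
    also have "\<dots> = ennreal (real (card B))"
      by (simp add: M.emeasure_space_1 ennreal_of_nat_eq_real_of_nat)
    also have "\<dots> < ennreal (\<epsilon> * real (card U))" using cardB by (simp add: ennreal_less_iff)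
    finally show False using \<epsilon>
      by (simp add: ennreal_of_nat_eq_real_of_nat mult.commute flip: ennreal_mult)
  qed
  then obtain v where v: "v \<in> U" "(\<integral>\<^sup>+\<omega>. ?l \<omega> v \<partial>M) \<le> ennreal \<epsilon>" by blast
  define g where "g = v \<otimes> inv x"
  have carr: "v \<in> carrier G" "s \<in> carrier G" "g \<in> carrier G" using v U s S x by (auto simp: g_def)
  then have gv: "inv g \<otimes> v = x" "inv g \<otimes> (v \<otimes> s) = x \<otimes> s"
    using x by (simp_all add: g_def inv_mult_group m_assoc[symmetric]) (simp_all add: m_assoc)
  show ?thesis
  proof (intro exI[of _ "(\<otimes>) (inv g) ` U"] conjI)
    show "x \<in> (\<otimes>) (inv g) ` U" using gv(1) v(1) by force
    show "(\<integral>\<^sup>+\<omega>. leverage (open_subgraph ?H \<omega>) ((\<otimes>) (inv g) ` U) x (x \<otimes> s) \<partial>M) \<le> ennreal \<epsilon>"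
      using expected_leverage_translate[OF S carr(3) U(1,2) v(1), of "v \<otimes> s" p] carr v(2)
      unfolding M_def gv by (meson m_closed order_trans)
  qed (use U carr in auto)
qed

lemma AE_small_leverage:
  assumes S: "finite S" "S \<subseteq> carrier G" and am: "amenable (cayley_graph G S)"
    and x: "x \<in> carrier G" and s: "s \<in> S"
  shows "AE \<omega> in bernoulli_percolation (cayley_graph G S) p.
    \<forall>\<delta>>0. \<exists>W. finite W \<and> leverage (open_subgraph (cayley_graph G S) \<omega>) W x (x \<otimes> s) < ennreal \<delta>"
proof -
  let ?M = "bernoulli_percolation (cayley_graph G S) p"
  let ?l = "\<lambda>W \<omega>. leverage (open_subgraph (cayley_graph G S) \<omega>) W x (x \<otimes> s)"
  have "\<forall>k. \<exists>W. finite W \<and> W \<subseteq> carrier G \<and> x \<in> W \<and> (\<integral>\<^sup>+\<omega>. ?l W \<omega> \<partial>?M) \<le> ennreal (1 / real (Suc k))"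
    by (rule allI, rule small_expected_leverage[OF S am x s]) simp
  from choice[OF this] obtain W where W: "\<And>k. finite (W k)" "\<And>k. W k \<subseteq> carrier G" "\<And>k. x \<in> W k"
    and small: "\<And>k. (\<integral>\<^sup>+\<omega>. ?l (W k) \<omega> \<partial>?M) \<le> ennreal (1 / real (Suc k))"
    by blast
  have meas: "?l (W k) \<in> borel_measurable ?M" for k
    using W S by (intro measurable_leverage wf_cayley_graph locally_finite_cayley_graph)
      (auto simp: cayley_graph_def)
  have "(\<integral>\<^sup>+\<omega>. (INF k. ?l (W k) \<omega>) \<partial>?M) \<le> ennreal (1 / real (Suc k))" for k
    by (rule order_trans[OF nn_integral_mono small[of k]]) (auto intro: INF_lower)
  moreover have "(\<lambda>k. ennreal (1 / real (Suc k))) \<longlonglongrightarrow> ennreal 0"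
    by (intro tendsto_ennrealI LIMSEQ_Suc[OF lim_1_over_n])
  ultimately have "(\<integral>\<^sup>+\<omega>. (INF k. ?l (W k) \<omega>) \<partial>?M) \<le> ennreal 0"
    by (intro LIMSEQ_le_const) auto
  then have "AE \<omega> in ?M. (INF k. ?l (W k) \<omega>) = 0"
    using meas by (subst (asm) ennreal_0) (simp add: nn_integral_0_iff_AE)
  then show ?thesis
  proof (rule AE_mp, intro AE_I2 impI allI)
    fix \<omega> and \<delta> :: real
    assume "(INF k. ?l (W k) \<omega>) = 0" "\<delta> > 0"
    then have "(INF k. ?l (W k) \<omega>) < ennreal \<delta>" by simp
    then show "\<exists>W. finite W \<and> ?l W \<omega> < ennreal \<delta>" using W(1) by (auto simp: INF_less_iff)
  qed
qed

end

theorem theorem1p9: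
  fixes G :: "('a, 'b) monoid_scheme" and S :: "'a set" and p :: real
  assumes "group G"
    and "finite S" and "S \<subseteq> carrier G" and "generate G S = carrier G"
    and "amenable (cayley_graph G S)"
    and "0 \<le> p" and "p \<le> 1"
  shows "AE \<omega> in bernoulli_percolation (cayley_graph G S) p.
           \<forall>C \<in> clusters (cayley_graph G S) \<omega>. C \<in> O_HD"
proof -
  interpret group G by fact
  let ?H = "cayley_graph G S"
  have H: "wf_ugraph ?H" "locally_finite ?H"
    using assms wf_cayley_graph locally_finite_cayley_graph by auto
  obtain V :: "nat \<Rightarrow> 'a set" where "\<And>n. finite (V n)" "(\<Union>n. V n) = carrier G"
    using assms(5) by (auto simp: amenable_def cayley_graph_def)
  then have "countable (carrier G)"
    using countable_UN[of UNIV V] by (simp add: countable_finite)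
  then have "AE \<omega> in bernoulli_percolation ?H p. \<forall>x\<in>carrier G. \<forall>s\<in>S.
      \<forall>\<delta>>0. \<exists>W. finite W \<and> leverage (open_subgraph ?H \<omega>) W x (x \<otimes>\<^bsub>G\<^esub> s) < ennreal \<delta>"
    using assms by (simp add: AE_ball_countable countable_finite AE_small_leverage)
  then show ?thesis
  proof (rule AE_mp, intro AE_I2 impI ballI)
    fix \<omega> C
    assume small: "\<forall>x\<in>carrier G. \<forall>s\<in>S. \<forall>\<delta>>0. \<exists>W. finite W \<and>
        leverage (open_subgraph ?H \<omega>) W x (x \<otimes>\<^bsub>G\<^esub> s) < ennreal \<delta>"
      and C: "C \<in> clusters ?H \<omega>"
    have "wf_ugraph (open_subgraph ?H \<omega>)"
      using H(1) by (auto simp: wf_ugraph_def open_subgraph_def)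
    moreover have "locally_finite (open_subgraph ?H \<omega>)"
      using H(2) by (simp add: locally_finite_def nbrs_open_subgraph vertices_open_subgraph)
    moreover have "\<exists>x y. e = {x, y} \<and>
        (\<forall>\<delta>>0. \<exists>W. finite W \<and> leverage (open_subgraph ?H \<omega>) W x y < ennreal \<delta>)"
      if "e \<in> edges (open_subgraph ?H \<omega>)" for e
    proof -
      have "e \<in> edges ?H" using that by (simp add: open_subgraph_def)
      then obtain g s where "e = {g, g \<otimes>\<^bsub>G\<^esub> s}" "g \<in> carrier G" "s \<in> S"
        unfolding cayley_graph_def ugraph.select_convs by blast
      then show ?thesis using small by blast
    qed
    ultimately show "C \<in> O_HD"
      using C by (auto simp: clusters_def components_def intro: component_in_O_HD)
  qed
qed

end
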